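(* Let $S=k[x_1,\ldots,x_n]$ be a polynomial ring over a field $k$ and $q\geq 2$. Let $I\subset S$ be the initial squarefree lexsegment ideal generated in degree $q$, determined by the monomial $v=x_{j_1}\cdots x_{j_q}$, with $2\leq j_1<\cdots<j_q\leq n$, $v\neq x_{n-q+1}\cdots x_n$, and let $\Delta$ be the simplicial complex with Stanley–Reisner ideal $I$. If $s$ is the smallest integer such that $j_i=j_1+(i-1)$ for all $1\leq i<s$ and $j_s\geq j_1+s$, then the multiplicity of $k[\Delta]$ is $e(k[\Delta])=s-1$.
   Context: Monomials are ordered by the lexicographic order with $x_1>x_2>\cdots>x_n$. For a squarefree monomial $v$ of degree $q$, $L^i(v)=\{w: w\text{ a squarefree monomial of degree }q,\ w\geq_{lex}v\}$ and the initial squarefree lexsegment ideal determined by $v$ is $(L^i(v))$. The Stanley–Reisner ideal of $\Delta$ is generated by the $\prod_{i\in G}x_i$ with $G\notin\Delta$, and $k[\Delta]=S/I$ is the Stanley–Reisner ring. $e(k[\Delta])$ is the (Hilbert–Samuel) multiplicity; it equals the number of facets of $\Delta$ of maximal dimension. *)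

theory Defs
  imports
    "HOL-Library.Poly_Mapping"
    "HOL-Library.Extended_Nat"
    "HOL-Computational_Algebra.Polynomial"
    "HOL-Algebra.QuotRing"
    "HOL-Algebra.Ideal_Product"
begin

section \<open>Polynomial rings and squarefree monomials\<close>

text \<open>A monomial is its exponent vector; the type \<open>'k mpoly\<close> has the variables
  \<open>x\<^sub>0, x\<^sub>1, \<dots>\<close>, of which \<open>k[x\<^sub>1, \<dots>, x\<^sub>n]\<close> uses the first \<open>n\<close> after \<open>x\<^sub>0\<close>.\<close>

type_synonym expvec = "nat \<Rightarrow>\<^sub>0 nat"

type_synonym 'k mpoly = "expvec \<Rightarrow>\<^sub>0 'k"

definition poly_ring :: "nat \<Rightarrow> 'k::field mpoly ring" where
  "poly_ring n =
    \<lparr>carrier = {p. \<forall>a \<in> Poly_Mapping.keys p. Poly_Mapping.keys a \<subseteq> {1..n}},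
     mult = (*), one = 1, zero = 0, add = (+)\<rparr>"

abbreviation monomial :: "expvec \<Rightarrow> 'k::field mpoly" where
  "monomial a \<equiv> Poly_Mapping.single a 1"

definition set_expvec :: "nat set \<Rightarrow> expvec" where
  "set_expvec G = (\<Sum>i\<in>G. Poly_Mapping.single i 1)"

definition mdeg :: "expvec \<Rightarrow> nat" where
  "mdeg a = (\<Sum>i\<in>Poly_Mapping.keys a. Poly_Mapping.lookup a i)"

definition sqfree_monomials :: "nat \<Rightarrow> nat \<Rightarrow> expvec set" where
  "sqfree_monomials n q =
    {a. Poly_Mapping.keys a \<subseteq> {1..n} \<and> (\<forall>i. Poly_Mapping.lookup a i \<le> 1) \<and> mdeg a = q}"

text \<open>The library order on exponent vectors decides at the smallest index where two
  vectors differ, so it is the lexicographic order with \<open>x\<^sub>1 > x\<^sub>2 > \<dots> > x\<^sub>n\<close>.\<close>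

definition initial_lexsegment :: "nat \<Rightarrow> expvec \<Rightarrow> expvec set" where
  "initial_lexsegment n v = {w \<in> sqfree_monomials n (mdeg v). v \<le> w}"

definition lexsegment_ideal :: "nat \<Rightarrow> expvec \<Rightarrow> 'k::field mpoly set" where
  "lexsegment_ideal n v = genideal (poly_ring n) (monomial ` initial_lexsegment n v)"


section \<open>Stanley--Reisner rings\<close>

definition simplicial_complex_on :: "nat set \<Rightarrow> nat set set \<Rightarrow> bool" where
  "simplicial_complex_on V \<Delta> \<longleftrightarrow> \<Delta> \<subseteq> Pow V \<and> (\<forall>F\<in>\<Delta>. \<forall>G. G \<subseteq> F \<longrightarrow> G \<in> \<Delta>)"

definition stanley_reisner_ideal :: "nat \<Rightarrow> nat set set \<Rightarrow> 'k::field mpoly set" where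
  "stanley_reisner_ideal n \<Delta> =
    genideal (poly_ring n) ((\<lambda>G. monomial (set_expvec G)) ` (Pow {1..n} - \<Delta>))"

definition stanley_reisner_ring :: "nat \<Rightarrow> nat set set \<Rightarrow> 'k::field mpoly set ring" where
  "stanley_reisner_ring n \<Delta> = poly_ring n Quot stanley_reisner_ideal n \<Delta>"

text \<open>The graded maximal ideal of \<open>k[\<Delta>]\<close>, generated by the residue classes of the variables.\<close>

definition stanley_reisner_max_ideal :: "nat \<Rightarrow> nat set set \<Rightarrow> 'k::field mpoly set set" where
  "stanley_reisner_max_ideal n \<Delta> =
    genideal (stanley_reisner_ring n \<Delta>)
      ((\<lambda>i. stanley_reisner_ideal n \<Delta> +>\<^bsub>poly_ring n\<^esub> monomial (Poly_Mapping.single i 1)) ` {1..n})"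


section \<open>Hilbert--Samuel multiplicity\<close>

primrec ideal_pow :: "('a, 'b) ring_scheme \<Rightarrow> 'a set \<Rightarrow> nat \<Rightarrow> 'a set" where
  "ideal_pow R J 0 = carrier R"
| "ideal_pow R J (Suc t) = ideal_prod R (ideal_pow R J t) J"

text \<open>The length of a commutative ring as a module over itself. For an ideal \<open>J\<close> of \<open>R\<close>
  the \<open>R\<close>-submodules of \<open>R/J\<close> are the ideals of the ring \<open>R/J\<close>, so the length of the
  \<open>R\<close>-module \<open>R/J\<close> is \<open>ring_length (R Quot J)\<close>.\<close>

definition ring_length :: "('a, 'b) ring_scheme \<Rightarrow> enat" where
  "ring_length R =
    Sup {enat l | l. \<exists>c :: nat \<Rightarrow> 'a set. (\<forall>i\<le>l. ideal (c i) R) \<and> (\<forall>i<l. c i \<subset> c (Suc i))}"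

definition hilbert_samuel_function :: "('a, 'b) ring_scheme \<Rightarrow> 'a set \<Rightarrow> nat \<Rightarrow> enat" where
  "hilbert_samuel_function R J t = ring_length (R Quot ideal_pow R J t)"

definition is_hilbert_samuel_poly :: "('a, 'b) ring_scheme \<Rightarrow> 'a set \<Rightarrow> rat poly \<Rightarrow> bool" where
  "is_hilbert_samuel_poly R J P \<longleftrightarrow>
    (\<forall>\<^sub>F t in sequentially.
      \<exists>h::nat. hilbert_samuel_function R J t = enat h \<and> poly P (of_nat t) = of_nat h)"

text \<open>The degree of the Hilbert--Samuel polynomial is the dimension \<open>d\<close>, and its leading
  coefficient is \<open>e / d!\<close>. The polynomial is unique when it exists, because two
  candidates agree at infinitely many points.\<close>

definition hilbert_samuel_poly :: "('a, 'b) ring_scheme \<Rightarrow> 'a set \<Rightarrow> rat poly" where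
  "hilbert_samuel_poly R J = (THE P. is_hilbert_samuel_poly R J P)"

definition hilbert_samuel_multiplicity :: "('a, 'b) ring_scheme \<Rightarrow> 'a set \<Rightarrow> rat" where
  "hilbert_samuel_multiplicity R J =
    fact (Polynomial.degree (hilbert_samuel_poly R J)) *
      Polynomial.lead_coeff (hilbert_samuel_poly R J)"


section \<open>The first gap of an index sequence\<close>

text \<open>The condition on \<open>r\<close> compares \<open>j\<^sub>r\<close> with \<open>j\<^sub>1 + r\<close>. For \<open>r = q + 1\<close> there is no
  \<open>j\<^sub>r\<close>, which is treated as infinite, so \<open>j\<^sub>1, \<dots>, j\<^sub>q\<close> consecutive means that the
  first gap is at \<open>q + 1\<close>.\<close>

definition gap_at :: "nat \<Rightarrow> (nat \<Rightarrow> nat) \<Rightarrow> nat \<Rightarrow> bool" where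
  "gap_at q j r \<longleftrightarrow>
    (\<forall>i. 1 \<le> i \<and> i < r \<longrightarrow> j i = j 1 + (i - 1)) \<and> (r \<le> q \<longrightarrow> j 1 + r \<le> j r)"

end

theory Submission
  imports Defs
begin

text \<open>The multiplicity of a Stanley--Reisner ring is the number of faces of maximal size, and for an
  initial squarefree lexsegment ideal these faces can be listed explicitly.

  For the first fact (\<open>multiplicity_stanley_reisner_ring\<close>), the length of the \<open>t\<close>-th quotient has to
  be computed. It is a quotient of the polynomial ring by a monomial ideal with only finitely many
  standard monomials, those of degree less than \<open>t\<close> whose support is a face. Length is defined by
  chains of ideals, and it equals the number of standard monomials
  (\<open>ring_length_monomial_quotient\<close>): the standard monomials can be adjoined one by one in decreasing
  lexicographic order, and conversely every strict step in a chain of ideals contributes a new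
  leading exponent. Exactly $\binom{t-1}{|F|}$ monomials of degree less than \<open>t\<close> have support \<open>F\<close>
  (\<open>exponents_with_support\<close>), so for \<open>t \<ge> 1\<close> the Hilbert--Samuel function is the polynomial
  $\sum_F \binom{t-1}{|F|}$. With \<open>d\<close> the maximal size of a face, its degree is \<open>d\<close> and its leading
  coefficient is the number of faces of size \<open>d\<close>, divided by \<open>d!\<close>.

  For the second fact (\<open>largest_lexsegment_faces\<close>), let \<open>V\<close> be the support of \<open>v\<close> and \<open>a\<close> its least
  element. A set is a nonface if and only if it contains a set of the size of \<open>V\<close> that is
  lexicographically at least \<open>V\<close>. The largest faces turn out to be the sets \<open>{a..n}\<close> with one element
  of the initial run of consecutive elements of \<open>V\<close> removed. This run is \<open>j\<^sub>1, \<dots>, j\<^bsub>s-1\<^esub>\<close>, which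
  gives \<open>s - 1\<close> faces.\<close>

section \<open>Polynomial rings and monomial ideals\<close>

lemma carrier_poly_ring:
  "p \<in> carrier (poly_ring n) \<longleftrightarrow> (\<forall>a\<in>Poly_Mapping.keys p. Poly_Mapping.keys a \<subseteq> {1..n})"
  by (simp add: poly_ring_def)

lemma poly_ring_ops [simp]:
  "x \<otimes>\<^bsub>poly_ring n\<^esub> y = x * y" "x \<oplus>\<^bsub>poly_ring n\<^esub> y = x + y"
  "\<one>\<^bsub>poly_ring n\<^esub> = 1" "\<zero>\<^bsub>poly_ring n\<^esub> = 0"
  by (simp_all add: poly_ring_def)

lemma keys_add_expvec:
  "Poly_Mapping.keys (a + b :: expvec) = Poly_Mapping.keys a \<union> Poly_Mapping.keys b"
  by (auto simp: in_keys_iff lookup_add)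

lemma keys_uminus_mpoly: "Poly_Mapping.keys (- p) = Poly_Mapping.keys (p :: 'k::field mpoly)"
  by (auto simp: in_keys_iff)

lemma cring_poly_ring: "cring (poly_ring n :: 'k::field mpoly ring)"
proof (rule cringI)
  show "abelian_group (poly_ring n :: 'k mpoly ring)"
  proof (rule abelian_groupI)
    fix x :: "'k mpoly" assume x: "x \<in> carrier (poly_ring n)"
    then have "- x \<in> carrier (poly_ring n)"
      by (simp add: carrier_poly_ring keys_uminus_mpoly)
    moreover have "- x \<oplus>\<^bsub>poly_ring n\<^esub> x = \<zero>\<^bsub>poly_ring n\<^esub>" by simp
    ultimately show "\<exists>y\<in>carrier (poly_ring n). y \<oplus>\<^bsub>poly_ring n\<^esub> x = \<zero>\<^bsub>poly_ring n\<^esub>"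
      by blast
  next
    fix x y :: "'k mpoly"
    assume "x \<in> carrier (poly_ring n)" "y \<in> carrier (poly_ring n)"
    then show "x \<oplus>\<^bsub>poly_ring n\<^esub> y \<in> carrier (poly_ring n)"
      using Poly_Mapping.keys_add[of x y] by (auto simp: carrier_poly_ring)
  qed (simp_all add: carrier_poly_ring ac_simps)
  show "comm_monoid (poly_ring n :: 'k mpoly ring)"
  proof (rule comm_monoidI)
    fix x y :: "'k mpoly"
    assume "x \<in> carrier (poly_ring n)" "y \<in> carrier (poly_ring n)"
    then show "x \<otimes>\<^bsub>poly_ring n\<^esub> y \<in> carrier (poly_ring n)"
      using keys_mult[of x y] by (fastforce simp: carrier_poly_ring keys_add_expvec)
  qed (simp_all add: carrier_poly_ring ac_simps)
qed (simp add: distrib_right)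

lemma a_inv_poly_ring:
  assumes "p \<in> carrier (poly_ring n)"
  shows "\<ominus>\<^bsub>poly_ring n\<^esub> p = - (p :: 'k::field mpoly)"
proof -
  interpret cring "poly_ring n :: 'k mpoly ring" by (rule cring_poly_ring)
  have "- p \<in> carrier (poly_ring n)"
    using assms by (simp add: carrier_poly_ring keys_uminus_mpoly)
  then show ?thesis
    using minus_equality[of "- p" p] assms by simp
qed

lemma mpoly_as_sum_of_terms:
  "p = (\<Sum>a\<in>Poly_Mapping.keys p. Poly_Mapping.single a (Poly_Mapping.lookup p a))"
proof (rule poly_mapping_eqI)
  fix b
  have "(\<Sum>a\<in>Poly_Mapping.keys p. Poly_Mapping.lookup p a when a = b) =
      (\<Sum>a\<in>Poly_Mapping.keys p. if a = b then Poly_Mapping.lookup p a else 0)"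
    by (rule sum.cong) (auto simp: when_def)
  then show "Poly_Mapping.lookup p b = Poly_Mapping.lookup
      (\<Sum>a\<in>Poly_Mapping.keys p. Poly_Mapping.single a (Poly_Mapping.lookup p a)) b"
    by (simp add: lookup_sum lookup_single in_keys_iff)
qed

lemma mem_of_terms:
  fixes p :: "'k::field mpoly"
  assumes "0 \<in> A" and "\<And>x y. x \<in> A \<Longrightarrow> y \<in> A \<Longrightarrow> x + y \<in> A"
    and "\<And>a. a \<in> Poly_Mapping.keys p \<Longrightarrow> Poly_Mapping.single a (Poly_Mapping.lookup p a) \<in> A"
  shows "p \<in> A"
proof -
  have "(\<Sum>a\<in>K. Poly_Mapping.single a (Poly_Mapping.lookup p a)) \<in> A"
    if "finite K" "K \<subseteq> Poly_Mapping.keys p" for K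
    using that by (induction K) (use assms in auto)
  from this[of "Poly_Mapping.keys p"] mpoly_as_sum_of_terms[of p] show ?thesis by simp
qed

definition monomial_span :: "nat \<Rightarrow> expvec set \<Rightarrow> 'k::field mpoly set" where
  "monomial_span n U = {p \<in> carrier (poly_ring n). Poly_Mapping.keys p \<subseteq> U}"

text \<open>Exponent sets closed under multiplication by monomials in the variables $x_1, \ldots, x_n$;
  these span monomial ideals. Elements of the set may involve further variables, which
  \<open>monomial_span\<close> discards; this allows complements such as \<open>- B\<close> to be used directly.\<close>

definition up_closed :: "nat \<Rightarrow> expvec set \<Rightarrow> bool" where
  "up_closed n U \<longleftrightarrow> (\<forall>a\<in>U. \<forall>b. Poly_Mapping.keys b \<subseteq> {1..n} \<longrightarrow> a + b \<in> U)"

lemma monomial_span_ideal: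
  assumes "up_closed n U"
  shows "ideal (monomial_span n U :: 'k::field mpoly set) (poly_ring n)"
proof -
  interpret cring "poly_ring n :: 'k mpoly ring" by (rule cring_poly_ring)
  have mult: "p * x \<in> monomial_span n U"
    if p: "p \<in> monomial_span n U" and x: "x \<in> carrier (poly_ring n)" for p x :: "'k mpoly"
  proof -
    have "p * x \<in> carrier (poly_ring n)"
      using that m_closed[of p x] by (simp add: monomial_span_def)
    moreover have "Poly_Mapping.keys (p * x) \<subseteq> U"
    proof
      fix c assume "c \<in> Poly_Mapping.keys (p * x)"
      then obtain a b where "c = a + b" "a \<in> Poly_Mapping.keys p" "b \<in> Poly_Mapping.keys x"
        using keys_mult[of p x] by blast
      then show "c \<in> U"
        using p x assms unfolding monomial_span_def up_closed_def carrier_poly_ring by blast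
    qed
    ultimately show ?thesis by (simp add: monomial_span_def)
  qed
  show ?thesis
  proof (rule idealI)
    show "subgroup (monomial_span n U) (add_monoid (poly_ring n :: 'k mpoly ring))"
    proof (rule add.subgroupI)
      show "monomial_span n U \<subseteq> (carrier (poly_ring n) :: 'k mpoly set)"
        by (auto simp: monomial_span_def)
    next
      fix p :: "'k mpoly" assume "p \<in> monomial_span n U"
      then show "\<ominus>\<^bsub>poly_ring n\<^esub> p \<in> monomial_span n U"
        by (simp add: monomial_span_def a_inv_poly_ring carrier_poly_ring keys_uminus_mpoly)
    next
      fix p x :: "'k mpoly" assume "p \<in> monomial_span n U" "x \<in> monomial_span n U"
      then show "p \<oplus>\<^bsub>poly_ring n\<^esub> x \<in> monomial_span n U"
        using Poly_Mapping.keys_add[of p x] a_closed[of p x] by (auto simp: monomial_span_def)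
    next
      have "0 \<in> (monomial_span n U :: 'k mpoly set)"
        by (simp add: monomial_span_def carrier_poly_ring)
      then show "(monomial_span n U :: 'k mpoly set) \<noteq> {}" by blast
    qed
  next
    show "ring (poly_ring n :: 'k mpoly ring)" by (rule ring_axioms)
  next
    fix p x :: "'k mpoly" assume "p \<in> monomial_span n U" "x \<in> carrier (poly_ring n)"
    then show "x \<otimes>\<^bsub>poly_ring n\<^esub> p \<in> monomial_span n U" "p \<otimes>\<^bsub>poly_ring n\<^esub> x \<in> monomial_span n U"
      using mult[of p x] by (simp_all add: mult.commute)
  qed
qed

lemma ideal_poly_ring_closed:
  fixes J :: "'k::field mpoly set"
  assumes "ideal J (poly_ring n)"
  shows "0 \<in> J" and "x \<in> J \<Longrightarrow> y \<in> J \<Longrightarrow> x + y \<in> J" and "x \<in> J \<Longrightarrow> y \<in> J \<Longrightarrow> x - y \<in> J"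
    and "x \<in> J \<Longrightarrow> p \<in> carrier (poly_ring n) \<Longrightarrow> p * x \<in> J"
    and "J \<subseteq> carrier (poly_ring n)"
proof -
  interpret cring "poly_ring n :: 'k mpoly ring" by (rule cring_poly_ring)
  interpret J: ideal J "poly_ring n" by (rule assms)
  show "0 \<in> J" and add: "\<And>x y. x \<in> J \<Longrightarrow> y \<in> J \<Longrightarrow> x + y \<in> J"
    using J.zero_closed J.a_closed by simp_all
  show "x \<in> J \<Longrightarrow> p \<in> carrier (poly_ring n) \<Longrightarrow> p * x \<in> J"
    using J.I_l_closed by fastforce
  show "J \<subseteq> carrier (poly_ring n)" by (rule J.a_subset)
  show "x - y \<in> J" if "x \<in> J" "y \<in> J"
    using add[of x "- y"] J.a_inv_closed[of y] a_inv_poly_ring[of y n] that J.a_subset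
    by auto
qed

text \<open>Both ideals in play, the Stanley--Reisner ideal and the lexsegment ideal, are described
  through this lemma: a term \<open>c x\<^sup>a\<close> with \<open>a = w + b\<close> is the multiple \<open>c x\<^sup>b\<close> of the generator \<open>x\<^sup>w\<close>,
  and a polynomial lies in an ideal spanned by monomials as soon as all its terms do.\<close>

lemma genideal_monomials:
  assumes "\<And>w. w \<in> W \<Longrightarrow> Poly_Mapping.keys w \<subseteq> {1..n}"
  shows "genideal (poly_ring n) (monomial ` W) =
    (monomial_span n {a. \<exists>w\<in>W. \<exists>b. a = w + b} :: 'k::field mpoly set)"
    (is "_ = monomial_span n ?U")
proof -
  interpret cring "poly_ring n :: 'k mpoly ring" by (rule cring_poly_ring)
  have gens: "monomial ` W \<subseteq> (carrier (poly_ring n) :: 'k mpoly set)"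
    using assms by (auto simp: carrier_poly_ring)
  have "up_closed n ?U"
    by (fastforce simp: up_closed_def add.assoc)
  then have "ideal (monomial_span n ?U :: 'k mpoly set) (poly_ring n)"
    by (rule monomial_span_ideal)
  moreover have "monomial ` W \<subseteq> (monomial_span n ?U :: 'k mpoly set)"
    using gens by (force simp: monomial_span_def intro: exI[of _ 0])
  moreover have "monomial_span n ?U \<subseteq> genideal (poly_ring n) (monomial ` W :: 'k mpoly set)"
  proof
    fix p :: "'k mpoly" assume p: "p \<in> monomial_span n ?U"
    note I = ideal_poly_ring_closed[OF genideal_ideal[OF gens]]
    show "p \<in> genideal (poly_ring n) (monomial ` W)"
    proof (rule mem_of_terms)
      fix a assume a: "a \<in> Poly_Mapping.keys p"
      then obtain w b where w: "w \<in> W" "a = w + b"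
        using p by (auto simp: monomial_span_def)
      then have "Poly_Mapping.keys b \<subseteq> {1..n}"
        using p a keys_add_expvec[of w b] by (simp add: monomial_span_def carrier_poly_ring) blast
      then have "Poly_Mapping.single b (Poly_Mapping.lookup p a) * monomial w \<in>
          genideal (poly_ring n) (monomial ` W)"
        using I(4) genideal_self[OF gens] w(1) by (auto simp: carrier_poly_ring)
      then show "Poly_Mapping.single a (Poly_Mapping.lookup p a) \<in>
          genideal (poly_ring n) (monomial ` W)"
        by (simp add: w(2) mult_single add.commute)
    qed (use I in auto)
  qed
  ultimately show ?thesis
    using genideal_minimal by blast
qed

section \<open>Chains of ideals and length\<close>

lemma (in ring_hom_ring) image_ideal:
  assumes surj: "h ` carrier R = carrier S" and J: "ideal J R"
  shows "ideal (h ` J) S"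
proof -
  interpret J: ideal J R by (rule J)
  show ?thesis
  proof (rule idealI)
    show "ring S" by (rule S.ring_axioms)
    show "subgroup (h ` J) (add_monoid S)"
      by (rule img_is_add_subgroup[OF J.a_subgroup])
  next
    fix a x assume "a \<in> h ` J" and "x \<in> carrier S"
    then obtain j r where jr: "j \<in> J" "a = h j" "r \<in> carrier R" "x = h r"
      using surj by (metis imageE)
    have "x \<otimes>\<^bsub>S\<^esub> a = h (r \<otimes> j)" "a \<otimes>\<^bsub>S\<^esub> x = h (j \<otimes> r)"
      using jr J.Icarr by simp_all
    then show "x \<otimes>\<^bsub>S\<^esub> a \<in> h ` J" "a \<otimes>\<^bsub>S\<^esub> x \<in> h ` J"
      using J.I_l_closed[OF jr(1,3)] J.I_r_closed[OF jr(1,3)] by blast+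
  qed
qed

definition ideal_chain_above :: "('a, 'b) ring_scheme \<Rightarrow> 'a set \<Rightarrow> nat \<Rightarrow> (nat \<Rightarrow> 'a set) \<Rightarrow> bool" where
  "ideal_chain_above R K l c \<longleftrightarrow>
    (\<forall>i\<le>l. ideal (c i) R \<and> K \<subseteq> c i) \<and> (\<forall>i<l. c i \<subset> c (Suc i))"

text \<open>Ideals of the target correspond to ideals of the source above the kernel, by taking images and
  preimages. The length of an iterated quotient of the polynomial ring can thus be computed
  with ideals of polynomials only.\<close>

lemma (in ring_hom_ring) ring_length_surj_image:
  assumes surj: "h ` carrier R = carrier S"
  shows "ring_length S = Sup {enat l | l. \<exists>c. ideal_chain_above R (a_kernel R S h) l c}"
proof -
  have "(\<exists>c. (\<forall>i\<le>l. ideal (c i) S) \<and> (\<forall>i<l. c i \<subset> c (Suc i))) \<longleftrightarrow>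
      (\<exists>c. ideal_chain_above R (a_kernel R S h) l c)" for l
  proof
    assume "\<exists>c. (\<forall>i\<le>l. ideal (c i) S) \<and> (\<forall>i<l. c i \<subset> c (Suc i))"
    then obtain c where c: "\<And>i. i \<le> l \<Longrightarrow> ideal (c i) S" "\<And>i. i < l \<Longrightarrow> c i \<subset> c (Suc i)"
      by blast
    let ?d = "\<lambda>i. {r \<in> carrier R. h r \<in> c i}"
    have "ideal (?d i) R" if "i \<le> l" for i
      by (rule ideal_vimage[OF c(1)[OF that]])
    moreover have "a_kernel R S h \<subseteq> ?d i" if "i \<le> l" for i
    proof -
      have "\<zero>\<^bsub>S\<^esub> \<in> c i"
        by (rule additive_subgroup.zero_closed[OF ideal.axioms(1)[OF c(1)[OF that]]])
      then show ?thesis unfolding a_kernel_def' by auto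
    qed
    moreover have "?d i \<subset> ?d (Suc i)" if i: "i < l" for i
    proof -
      obtain y where y: "y \<in> c (Suc i)" "y \<notin> c i" using c(2)[OF i] by blast
      then have "y \<in> carrier S" using ideal.Icarr[OF c(1)[of "Suc i"]] i by simp
      then obtain r where "r \<in> carrier R" "y = h r" using surj by (metis imageE)
      then show ?thesis using y c(2)[OF i] by blast
    qed
    ultimately show "\<exists>c. ideal_chain_above R (a_kernel R S h) l c"
      unfolding ideal_chain_above_def by (intro exI[of _ ?d]) blast
  next
    assume "\<exists>c. ideal_chain_above R (a_kernel R S h) l c"
    then obtain c where c: "\<And>i. i \<le> l \<Longrightarrow> ideal (c i) R" "\<And>i. i < l \<Longrightarrow> c i \<subset> c (Suc i)"
      and ker: "\<And>i. i \<le> l \<Longrightarrow> a_kernel R S h \<subseteq> c i"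
      unfolding ideal_chain_above_def by blast
    have "h ` c i \<subset> h ` c (Suc i)" if i: "i < l" for i
    proof -
      interpret I: ideal "c i" R using c(1) i by simp
      obtain r where r: "r \<in> c (Suc i)" "r \<notin> c i" using c(2)[OF i] by blast
      then have rc: "r \<in> carrier R" using ideal.Icarr[OF c(1)[of "Suc i"]] i by simp
      have "h r \<notin> h ` c i"
      proof
        assume "h r \<in> h ` c i"
        then obtain r' where r': "r' \<in> c i" "h r = h r'" by blast
        have r'c: "r' \<in> carrier R" using r' I.Icarr by blast
        have neg: "\<ominus> r' \<in> carrier R" by (rule R.a_inv_closed[OF r'c])
        have "h (r \<oplus> (\<ominus> r')) = h r \<oplus>\<^bsub>S\<^esub> (\<ominus>\<^bsub>S\<^esub> h r')"
          by (simp only: hom_add[OF rc neg] hom_a_inv[OF r'c])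
        also have "\<dots> = \<zero>\<^bsub>S\<^esub>"
          unfolding r'(2) by (rule S.r_neg[OF hom_closed[OF r'c]])
        finally have "r \<oplus> (\<ominus> r') \<in> a_kernel R S h"
          unfolding a_kernel_def' using R.a_closed[OF rc neg] by blast
        then have "r \<oplus> (\<ominus> r') \<in> c i" using ker[OF less_imp_le[OF i]] by blast
        then have "(r \<oplus> (\<ominus> r')) \<oplus> r' \<in> c i" using r'(1) I.a_closed by blast
        moreover have "(r \<oplus> (\<ominus> r')) \<oplus> r' = r"
          by (simp only: R.a_assoc[OF rc neg r'c] R.l_neg[OF r'c] R.r_zero[OF rc])
        ultimately show False using r(2) by simp
      qed
      then show ?thesis using r(1) c(2)[OF i] by blast
    qed
    then show "\<exists>c. (\<forall>i\<le>l. ideal (c i) S) \<and> (\<forall>i<l. c i \<subset> c (Suc i))"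
      using image_ideal[OF surj c(1)] by (intro exI[of _ "\<lambda>i. h ` c i"]) blast
  qed
  then show ?thesis unfolding ring_length_def by simp
qed

text \<open>The leading exponent of a polynomial is here taken among the exponents in \<open>B\<close> only, all others
  being ignored. For an ideal that contains every monomial outside \<open>B\<close> this amounts to the
  leading monomials of its image in the quotient with basis \<open>B\<close>.\<close>

definition leading_exponents :: "expvec set \<Rightarrow> 'k::field mpoly set \<Rightarrow> expvec set" where
  "leading_exponents B C =
    {b \<in> B. \<exists>p\<in>C. b \<in> Poly_Mapping.keys p \<and> (\<forall>b'\<in>B. b < b' \<longrightarrow> b' \<notin> Poly_Mapping.keys p)}"

text \<open>Gaussian elimination: if \<open>C\<close> and \<open>D\<close> had the same leading exponents, the leading term of
  any \<open>p \<in> D\<close> could be cancelled by a scalar multiple of an element of \<open>C\<close>. Iterating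
  this pushes the part of \<open>p\<close> supported on the finite set \<open>B\<close> down until nothing is left of it,
  and a polynomial without exponents in \<open>B\<close> lies in \<open>C\<close> by assumption.\<close>

lemma leading_exponents_strict_mono:
  fixes C D :: "'k::field mpoly set"
  assumes B: "finite B"
    and C: "ideal C (poly_ring n)" "monomial_span n (- B) \<subseteq> C"
    and D: "ideal D (poly_ring n)" and CD: "C \<subset> D"
  shows "leading_exponents B C \<subset> leading_exponents B D"
proof (rule ccontr)
  assume "\<not> leading_exponents B C \<subset> leading_exponents B D"
  moreover have "leading_exponents B C \<subseteq> leading_exponents B D"
    using CD by (auto simp: leading_exponents_def)
  ultimately have eq: "leading_exponents B D = leading_exponents B C" by blast
  have "p \<in> C" if "p \<in> D" for p
    using that
  proof (induction "card {b \<in> B. \<exists>b'\<in>Poly_Mapping.keys p \<inter> B. b \<le> b'}" arbitrary: p rule: less_induct)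
    case (less p)
    show ?case
    proof (cases "Poly_Mapping.keys p \<inter> B = {}")
      case True
      then have "p \<in> monomial_span n (- B)"
        using less.prems ideal_poly_ring_closed(5)[OF D] by (auto simp: monomial_span_def)
      then show ?thesis using C(2) by blast
    next
      case False
      define m where "m = Max (Poly_Mapping.keys p \<inter> B)"
      have m: "m \<in> Poly_Mapping.keys p" "m \<in> B"
        using Max_in[of "Poly_Mapping.keys p \<inter> B"] False by (auto simp: m_def)
      have m_max: "b \<le> m" if "b \<in> Poly_Mapping.keys p" "b \<in> B" for b
        using that by (simp add: m_def)
      then have "m \<in> leading_exponents B D"
        unfolding leading_exponents_def using m less.prems m_max by (blast dest: leD)
      then obtain g where g: "g \<in> C" "m \<in> Poly_Mapping.keys g"
        and g_max: "\<And>b. b \<in> B \<Longrightarrow> m < b \<Longrightarrow> b \<notin> Poly_Mapping.keys g"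
        unfolding eq by (auto simp: leading_exponents_def)
      (* the multiple of g that cancels the coefficient of p at m *)
      define c where "c = Poly_Mapping.lookup p m / Poly_Mapping.lookup g m"
      define r where "r = p - Poly_Mapping.single 0 c * g"
      have const: "(Poly_Mapping.single 0 c :: 'k mpoly) \<in> carrier (poly_ring n)"
        by (simp add: carrier_poly_ring)
      have cg: "Poly_Mapping.single 0 c * g \<in> C"
        by (rule ideal_poly_ring_closed(4)[OF C(1) g(1) const])
      have look: "Poly_Mapping.lookup r b = Poly_Mapping.lookup p b - c * Poly_Mapping.lookup g b" for b
        unfolding r_def mult_map_scale_conv_mult[symmetric]
        by (simp add: lookup_minus Poly_Mapping.map.rep_eq when_def)
      have below: "b < m" if "b \<in> Poly_Mapping.keys r \<inter> B" for b
      proof -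
        have "b \<noteq> m" using that g(2) by (auto simp: look c_def in_keys_iff)
        moreover have "\<not> m < b"
        proof
          assume "m < b"
          then have "b \<notin> Poly_Mapping.keys p" "b \<notin> Poly_Mapping.keys g"
            using that m_max[of b] g_max[of b] by auto
          then show False using that by (simp add: look in_keys_iff)
        qed
        ultimately show ?thesis by simp
      qed
      have "{b \<in> B. \<exists>b'\<in>Poly_Mapping.keys r \<inter> B. b \<le> b'} \<subset>
          {b \<in> B. \<exists>b'\<in>Poly_Mapping.keys p \<inter> B. b \<le> b'}"
      proof
        show "{b \<in> B. \<exists>b'\<in>Poly_Mapping.keys r \<inter> B. b \<le> b'} \<subseteq>
            {b \<in> B. \<exists>b'\<in>Poly_Mapping.keys p \<inter> B. b \<le> b'}"
          using m below by (blast intro: order.trans less_imp_le)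
        have "m \<in> {b \<in> B. \<exists>b'\<in>Poly_Mapping.keys p \<inter> B. b \<le> b'}"
          using m by blast
        moreover have "m \<notin> {b \<in> B. \<exists>b'\<in>Poly_Mapping.keys r \<inter> B. b \<le> b'}"
          using below by (auto dest: leD)
        ultimately show "{b \<in> B. \<exists>b'\<in>Poly_Mapping.keys r \<inter> B. b \<le> b'} \<noteq>
            {b \<in> B. \<exists>b'\<in>Poly_Mapping.keys p \<inter> B. b \<le> b'}" by metis
      qed
      then have "card {b \<in> B. \<exists>b'\<in>Poly_Mapping.keys r \<inter> B. b \<le> b'} <
          card {b \<in> B. \<exists>b'\<in>Poly_Mapping.keys p \<inter> B. b \<le> b'}"
        using B by (simp add: psubset_card_mono)
      moreover have "r \<in> D"
        unfolding r_def using ideal_poly_ring_closed(3)[OF D] less.prems cg CD by blast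
      ultimately have "r \<in> C" by (rule less.hyps)
      moreover have "p = r + Poly_Mapping.single 0 c * g" by (simp add: r_def)
      ultimately show ?thesis using ideal_poly_ring_closed(2)[OF C(1)] cg by metis
    qed
  qed
  then show False using CD by blast
qed

text \<open>The sets of leading exponents of the ideals in a chain grow strictly inside \<open>B\<close>.\<close>

lemma ideal_chain_above_bound:
  fixes c :: "nat \<Rightarrow> 'k::field mpoly set"
  assumes B: "finite B"
    and c: "ideal_chain_above (poly_ring n) (monomial_span n (- B)) l c"
  shows "l \<le> card B"
proof -
  have fin: "finite (leading_exponents B C)" for C :: "'k mpoly set"
    using B by (auto simp: leading_exponents_def)
  have "i \<le> card (leading_exponents B (c i))" if "i \<le> l" for i
    using that
  proof (induction i)
    case (Suc i)
    have "leading_exponents B (c i) \<subset> leading_exponents B (c (Suc i))"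
      using Suc.prems c by (intro leading_exponents_strict_mono[where n = n])
        (auto simp: ideal_chain_above_def B)
    from psubset_card_mono[OF fin this] Suc show ?case by simp
  qed simp
  from this[of l] have "l \<le> card (leading_exponents B (c l))" by simp
  also have "\<dots> \<le> card B"
    by (rule card_mono[OF B]) (auto simp: leading_exponents_def)
  finally show ?thesis .
qed

text \<open>Since the order is invariant under addition, no monomial exceeds a multiple of itself.\<close>

lemma expvec_nonneg: "(0 :: expvec) \<le> a"
proof (cases "a = 0")
  case False
  define i where "i = (LEAST i. Poly_Mapping.lookup a i \<noteq> 0)"
  have "Poly_Mapping.lookup a i \<noteq> 0"
    unfolding i_def using False by (metis (mono_tags, lifting) LeastI lookup_zero poly_mapping_eqI)
  moreover have "Poly_Mapping.lookup a k = 0" if "k < i" for k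
    using not_less_Least that unfolding i_def by blast
  ultimately have "0 < a"
    unfolding less_poly_mapping.rep_eq less_fun_def by (intro exI[of _ i]) auto
  then show ?thesis by simp
qed simp

text \<open>The bound is attained by adding the monomials of \<open>B\<close> to the ideal one at a time, always the
  lexicographically largest remaining one: its proper multiples are larger still, hence already
  in the ideal, and so the spans remain ideals.\<close>

lemma exists_ideal_chain_above:
  assumes "finite B" and "\<And>b. b \<in> B \<Longrightarrow> Poly_Mapping.keys b \<subseteq> {1..n}" and "up_closed n (- B)"
  shows "\<exists>c :: nat \<Rightarrow> 'k::field mpoly set.
    ideal_chain_above (poly_ring n) (monomial_span n (- B)) (card B) c"
  using assms
proof (induction "card B" arbitrary: B)
  case 0
  then show ?case
    unfolding ideal_chain_above_def
    by (intro exI[of _ "\<lambda>_. monomial_span n (- B)"]) (auto intro: monomial_span_ideal)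
next
  case (Suc N)
  define m where "m = Max B"
  have ne: "B \<noteq> {}" using Suc.hyps(2) by auto
  then have m: "m \<in> B" using Suc.prems(1) by (simp add: m_def)
  define B' where "B' = B - {m}"
  have card: "N = card B'" using Suc.hyps(2) Suc.prems(1) m by (simp add: B'_def)
  have up: "up_closed n (- B')"
    unfolding up_closed_def
  proof (intro ballI allI impI)
    fix a b :: expvec assume a: "a \<in> - B'" and b: "Poly_Mapping.keys (b :: expvec) \<subseteq> {1..n}"
    show "a + b \<in> - B'"
    proof (cases "a = m")
      case True
      have "m \<le> m + b" using add_left_mono[OF expvec_nonneg[of b], of m] by simp
      then show ?thesis
        using True Max_ge[OF Suc.prems(1), of "m + b"] by (auto simp: B'_def m_def)
    next
      case False
      then have "a + b \<in> - B"
        using a b Suc.prems(3) by (auto simp: B'_def up_closed_def)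
      then show ?thesis by (auto simp: B'_def)
    qed
  qed
  have "\<exists>c :: nat \<Rightarrow> 'k mpoly set.
      ideal_chain_above (poly_ring n) (monomial_span n (- B')) (card B') c"
    using Suc.prems(1,2) by (intro Suc.hyps(1) card up) (auto simp: B'_def)
  then obtain c :: "nat \<Rightarrow> 'k mpoly set"
    where c: "ideal_chain_above (poly_ring n) (monomial_span n (- B')) N c"
    using card by blast
  have sub: "monomial_span n (- B) \<subseteq> (monomial_span n (- B') :: 'k mpoly set)"
    by (auto simp: monomial_span_def B'_def)
  have "monomial m \<in> (monomial_span n (- B') :: 'k mpoly set)"
    using Suc.prems(2)[OF m] by (simp add: monomial_span_def carrier_poly_ring B'_def)
  moreover have "monomial m \<notin> (monomial_span n (- B) :: 'k mpoly set)"
    using m by (simp add: monomial_span_def)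
  ultimately have strict: "monomial_span n (- B) \<subset> (monomial_span n (- B') :: 'k mpoly set)"
    using sub by blast
  have "ideal_chain_above (poly_ring n) (monomial_span n (- B)) (Suc N)
      (case_nat (monomial_span n (- B)) c)"
    unfolding ideal_chain_above_def
  proof (intro conjI allI impI)
    fix i assume "i \<le> Suc N"
    then show "ideal (case i of 0 \<Rightarrow> monomial_span n (- B) | Suc x \<Rightarrow> c x) (poly_ring n)"
      "monomial_span n (- B) \<subseteq> (case i of 0 \<Rightarrow> monomial_span n (- B) | Suc x \<Rightarrow> c x)"
      using c sub monomial_span_ideal[OF Suc.prems(3)]
      by (auto simp: ideal_chain_above_def split: nat.split)
  next
    fix i assume "i < Suc N"
    then show "(case i of 0 \<Rightarrow> monomial_span n (- B) | Suc x \<Rightarrow> c x) \<subset>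
        (case Suc i of 0 \<Rightarrow> monomial_span n (- B) | Suc x \<Rightarrow> c x)"
      using c strict by (auto simp: ideal_chain_above_def split: nat.split)
  qed
  then show ?case using Suc.hyps(2) by metis
qed

lemma ring_length_monomial_quotient:
  fixes h :: "'k::field mpoly \<Rightarrow> 'a"
  assumes h: "ring_hom_ring (poly_ring n) T h" "h ` carrier (poly_ring n) = carrier T"
    and ker: "a_kernel (poly_ring n) T h = monomial_span n (- B)"
    and B: "finite B" "\<And>b. b \<in> B \<Longrightarrow> Poly_Mapping.keys b \<subseteq> {1..n}" "up_closed n (- B)"
  shows "ring_length T = enat (card B)"
proof -
  let ?L = "{enat l | l. \<exists>c. ideal_chain_above (poly_ring n) (monomial_span n (- B) :: 'k mpoly set) l c}"
  have "ring_length T = Sup ?L"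
    using ring_hom_ring.ring_length_surj_image[OF h] by (simp add: ker)
  moreover have "Sup ?L = enat (card B)"
  proof (rule antisym)
    show "Sup ?L \<le> enat (card B)"
      using ideal_chain_above_bound[OF B(1)] by (intro Sup_least) auto
    show "enat (card B) \<le> Sup ?L"
      using exists_ideal_chain_above[OF B] by (intro Sup_upper) blast
  qed
  ultimately show ?thesis by simp
qed

section \<open>Stanley--Reisner ideals and powers of the irrelevant ideal\<close>

lemma lookup_set_expvec:
  "finite G \<Longrightarrow> Poly_Mapping.lookup (set_expvec G) i = (if i \<in> G then 1 else 0)"
  by (simp add: set_expvec_def lookup_sum lookup_single when_def)

lemma keys_set_expvec: "finite G \<Longrightarrow> Poly_Mapping.keys (set_expvec G) = G"
  by (auto simp: in_keys_iff lookup_set_expvec split: if_splits)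

lemma expvec_divides_iff:
  fixes a w :: expvec
  shows "(\<exists>b. a = w + b) \<longleftrightarrow> (\<forall>i. Poly_Mapping.lookup w i \<le> Poly_Mapping.lookup a i)"
proof
  assume "\<forall>i. Poly_Mapping.lookup w i \<le> Poly_Mapping.lookup a i"
  then have "a = w + (a - w)"
    by (intro poly_mapping_eqI) (simp add: lookup_add lookup_minus)
  then show "\<exists>b. a = w + b" by blast
qed (auto simp: lookup_add)

lemma set_expvec_divides_iff:
  assumes "finite G"
  shows "(\<exists>b. a = set_expvec G + b) \<longleftrightarrow> G \<subseteq> Poly_Mapping.keys a"
  unfolding expvec_divides_iff
  using assms by (auto simp: lookup_set_expvec in_keys_iff Suc_le_eq)

lemma stanley_reisner_ideal_eq:
  assumes "simplicial_complex_on {1..n} \<Delta>"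
  shows "stanley_reisner_ideal n \<Delta> =
    (monomial_span n {a. Poly_Mapping.keys a \<notin> \<Delta>} :: 'k::field mpoly set)"
proof -
  let ?W = "set_expvec ` (Pow {1..n} - \<Delta>)"
  have fin: "finite G" if "G \<in> Pow {1..n} - \<Delta>" for G
    using that finite_subset by auto
  have "stanley_reisner_ideal n \<Delta> = genideal (poly_ring n) (monomial ` ?W :: 'k mpoly set)"
    by (simp add: stanley_reisner_ideal_def image_image)
  also have "\<dots> = monomial_span n {a. \<exists>w\<in>?W. \<exists>b. a = w + b}"
  proof (rule genideal_monomials)
    fix w assume "w \<in> ?W"
    then obtain G where G: "G \<in> Pow {1..n} - \<Delta>" "w = set_expvec G" by blast
    then show "Poly_Mapping.keys w \<subseteq> {1..n}"
      using keys_set_expvec[OF fin[OF G(1)]] by simp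
  qed
  also have "{a. \<exists>w\<in>?W. \<exists>b. a = w + b} = {a. \<exists>G\<in>Pow {1..n} - \<Delta>. G \<subseteq> Poly_Mapping.keys a}"
    using fin set_expvec_divides_iff by auto
  also have "monomial_span n \<dots> = (monomial_span n {a. Poly_Mapping.keys a \<notin> \<Delta>} :: 'k mpoly set)"
  proof -
    have "(\<exists>G\<in>Pow {1..n} - \<Delta>. G \<subseteq> Poly_Mapping.keys a) \<longleftrightarrow> Poly_Mapping.keys a \<notin> \<Delta>"
      if a: "Poly_Mapping.keys a \<subseteq> {1..n}" for a :: expvec
    proof
      assume "\<exists>G\<in>Pow {1..n} - \<Delta>. G \<subseteq> Poly_Mapping.keys a"
      then show "Poly_Mapping.keys a \<notin> \<Delta>"
        using assms unfolding simplicial_complex_on_def by (meson DiffD2)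
    next
      assume "Poly_Mapping.keys a \<notin> \<Delta>"
      then show "\<exists>G\<in>Pow {1..n} - \<Delta>. G \<subseteq> Poly_Mapping.keys a"
        using a by (intro bexI[of _ "Poly_Mapping.keys a"]) auto
    qed
    then show ?thesis by (auto simp: monomial_span_def carrier_poly_ring subset_iff)
  qed
  finally show ?thesis .
qed

lemma mdeg_eq_sum:
  assumes "finite A" "Poly_Mapping.keys a \<subseteq> A"
  shows "mdeg a = (\<Sum>i\<in>A. Poly_Mapping.lookup a i)"
  unfolding mdeg_def
  by (rule sum.mono_neutral_left) (use assms in \<open>auto simp: in_keys_iff\<close>)

lemma mdeg_add: "mdeg (a + b) = mdeg a + mdeg b"
  using mdeg_eq_sum[of "Poly_Mapping.keys a \<union> Poly_Mapping.keys b"]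
  by (simp add: keys_add_expvec lookup_add sum.distrib)

lemma mdeg_single [simp]: "mdeg (Poly_Mapping.single i e) = e"
  by (simp add: mdeg_def)

lemma split_off_variable:
  assumes "i \<in> Poly_Mapping.keys (a :: expvec)"
  obtains b where "a = Poly_Mapping.single i 1 + b"
proof -
  have "\<exists>b. a = Poly_Mapping.single i 1 + b"
    unfolding expvec_divides_iff using assms
    by (auto simp: lookup_single when_def in_keys_iff)
  then show thesis using that by blast
qed

lemma mdeg_pos_obtain:
  assumes "0 < mdeg a"
  obtains i where "i \<in> Poly_Mapping.keys a"
proof -
  have "Poly_Mapping.keys a \<noteq> {}" using assms by (auto simp: mdeg_def)
  then show thesis using that by blast
qed

lemma up_closed_mdeg: "up_closed n {a. t \<le> mdeg a}"
  by (auto simp: up_closed_def mdeg_add)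

lemma genideal_variables:
  "genideal (poly_ring n) ((\<lambda>i. monomial (Poly_Mapping.single i 1)) ` {1..n}) =
    (monomial_span n {a. 1 \<le> mdeg a} :: 'k::field mpoly set)"
proof -
  let ?W = "(\<lambda>i. Poly_Mapping.single i 1 :: expvec) ` {1..n}"
  have "genideal (poly_ring n) ((\<lambda>i. monomial (Poly_Mapping.single i 1)) ` {1..n}) =
      genideal (poly_ring n) (monomial ` ?W :: 'k mpoly set)"
    by (simp add: image_image)
  also have "\<dots> = monomial_span n {a. \<exists>w\<in>?W. \<exists>b. a = w + b}"
    by (rule genideal_monomials) auto
  also have "\<dots> = monomial_span n {a. 1 \<le> mdeg a}"
  proof -
    have "(\<exists>w\<in>?W. \<exists>b. a = w + b) \<longleftrightarrow> 1 \<le> mdeg a" if a: "Poly_Mapping.keys a \<subseteq> {1..n}" for a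
    proof
      assume "1 \<le> mdeg a"
      then obtain i where i: "i \<in> Poly_Mapping.keys a" using mdeg_pos_obtain[of a] by auto
      then obtain b where "a = Poly_Mapping.single i 1 + b" by (rule split_off_variable)
      then show "\<exists>w\<in>?W. \<exists>b. a = w + b" using i a by blast
    qed (auto simp: mdeg_add)
    then show ?thesis unfolding monomial_span_def carrier_poly_ring by blast
  qed
  finally show ?thesis .
qed

text \<open>The powers of the irrelevant ideal are computed upstairs, in the polynomial ring. The target
  is arbitrary, so that the description applies to the Stanley--Reisner ring as a quotient
  without choosing representatives.\<close>

lemma max_ideal_image:
  fixes h :: "'k::field mpoly \<Rightarrow> 'a"
  assumes h: "ring_hom_ring (poly_ring n) T h" and surj: "h ` carrier (poly_ring n) = carrier T"
  shows "genideal T ((\<lambda>i. h (monomial (Poly_Mapping.single i 1))) ` {1..n}) =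
    h ` monomial_span n {a. 1 \<le> mdeg a}"
    (is "genideal T ?X = h ` ?A")
proof -
  interpret h: ring_hom_ring "poly_ring n :: 'k mpoly ring" T h by (rule h)
  let ?V = "(\<lambda>i. monomial (Poly_Mapping.single i 1)) ` {1..n} :: 'k mpoly set"
  have V: "?V \<subseteq> carrier (poly_ring n)" by (auto simp: carrier_poly_ring)
  have X: "?X = h ` ?V" by (simp add: image_image)
  have XT: "?X \<subseteq> carrier T" unfolding X using V surj by blast
  have A: "?V \<subseteq> ?A" using h.R.genideal_self[OF V] unfolding genideal_variables .
  show ?thesis
  proof
    have "ideal (h ` ?A) T"
      by (rule h.image_ideal[OF surj monomial_span_ideal[OF up_closed_mdeg]])
    then show "genideal T ?X \<subseteq> h ` ?A"
      by (rule h.S.genideal_minimal) (use A X in blast)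
    have "genideal (poly_ring n) ?V \<subseteq> {p \<in> carrier (poly_ring n). h p \<in> genideal T ?X}"
    proof (rule h.R.genideal_minimal)
      show "ideal {p \<in> carrier (poly_ring n). h p \<in> genideal T ?X} (poly_ring n)"
        by (rule h.ideal_vimage[OF h.S.genideal_ideal[OF XT]])
      show "?V \<subseteq> {p \<in> carrier (poly_ring n). h p \<in> genideal T ?X}"
        using V h.S.genideal_self[OF XT] unfolding X by blast
    qed
    then show "h ` ?A \<subseteq> genideal T ?X" unfolding genideal_variables by blast
  qed
qed

text \<open>A monomial of degree at least \<open>t + 1\<close> is a variable times a monomial of degree at least \<open>t\<close>,
  which gives the inclusion from right to left in the induction step.\<close>

lemma max_ideal_pow_image:
  fixes h :: "'k::field mpoly \<Rightarrow> 'a"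
  assumes h: "ring_hom_ring (poly_ring n) T h" and surj: "h ` carrier (poly_ring n) = carrier T"
  shows "ideal_pow T (h ` monomial_span n {a. 1 \<le> mdeg a}) t = h ` monomial_span n {a. t \<le> mdeg a}"
proof (induction t)
  case 0
  have "monomial_span n {a. 0 \<le> mdeg a} = (carrier (poly_ring n) :: 'k mpoly set)"
    by (auto simp: monomial_span_def)
  then show ?case by (simp add: surj)
next
  case (Suc t)
  interpret h: ring_hom_ring "poly_ring n :: 'k mpoly ring" T h by (rule h)
  let ?A = "\<lambda>t. monomial_span n {a. t \<le> mdeg a} :: 'k mpoly set"
  have A: "ideal (?A t) (poly_ring n)" for t by (rule monomial_span_ideal[OF up_closed_mdeg])
  have hA: "ideal (h ` ?A t) T" for t by (rule h.image_ideal[OF surj A])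
  have "ideal_prod T (h ` ?A t) (h ` ?A 1) = h ` ?A (Suc t)"
  proof
    show "ideal_prod T (h ` ?A t) (h ` ?A 1) \<subseteq> h ` ?A (Suc t)"
    proof
      fix x assume "x \<in> ideal_prod T (h ` ?A t) (h ` ?A 1)"
      then show "x \<in> h ` ?A (Suc t)"
      proof induction
        case (prod x y)
        then obtain p q where pq: "p \<in> ?A t" "x = h p" "q \<in> ?A 1" "y = h q" by blast
        have c: "p \<in> carrier (poly_ring n)" "q \<in> carrier (poly_ring n)"
          using pq by (auto simp: monomial_span_def)
        have "p * q \<in> ?A (Suc t)"
        proof -
          have "Suc t \<le> mdeg a" if a: "a \<in> Poly_Mapping.keys (p * q)" for a
          proof -
            obtain b d where b: "a = b + d" "b \<in> Poly_Mapping.keys p" "d \<in> Poly_Mapping.keys q"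
              using keys_mult[of p q] a by blast
            then have "t \<le> mdeg b" "1 \<le> mdeg d" using pq by (auto simp: monomial_span_def)
            then show ?thesis by (simp add: b(1) mdeg_add)
          qed
          moreover have "p * q \<in> carrier (poly_ring n)"
            using h.R.m_closed[OF c] by simp
          ultimately show ?thesis by (auto simp: monomial_span_def)
        qed
        moreover have "x \<otimes>\<^bsub>T\<^esub> y = h (p * q)"
          using h.hom_mult[OF c] pq by simp
        ultimately show ?case by blast
      next
        case (sum x y)
        then show ?case by (intro additive_subgroup.a_closed[OF ideal.axioms(1)[OF hA]])
      qed
    qed
    have P: "ideal (ideal_prod T (h ` ?A t) (h ` ?A 1)) T"
      by (rule h.S.ideal_prod_is_ideal[OF hA hA])
    let ?P = "{p \<in> carrier (poly_ring n). h p \<in> ideal_prod T (h ` ?A t) (h ` ?A 1)}"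
    note closed = ideal_poly_ring_closed[OF h.ideal_vimage[OF P]]
    have "?A (Suc t) \<subseteq> ?P"
    proof
      fix p assume p: "p \<in> ?A (Suc t)"
      show "p \<in> ?P"
      proof (rule mem_of_terms)
        fix a assume a: "a \<in> Poly_Mapping.keys p"
        then have deg: "Suc t \<le> mdeg a" using p by (auto simp: monomial_span_def)
        then obtain i where i: "i \<in> Poly_Mapping.keys a" using mdeg_pos_obtain[of a] by auto
        then obtain b where b: "a = Poly_Mapping.single i 1 + b" by (rule split_off_variable)
        have ka: "Poly_Mapping.keys a \<subseteq> {1..n}"
          using p a by (simp add: monomial_span_def carrier_poly_ring)
        then have kb: "Poly_Mapping.keys b \<subseteq> {1..n}"
          using keys_add_expvec[of "Poly_Mapping.single i 1" b] unfolding b by blast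
        let ?c = "Poly_Mapping.single b (Poly_Mapping.lookup p a)"
        let ?x = "monomial (Poly_Mapping.single i 1) :: 'k mpoly"
        have x: "?c \<in> ?A t" "?x \<in> ?A 1"
          using kb ka i deg b by (auto simp: monomial_span_def carrier_poly_ring mdeg_add)
        then have xc: "?c \<in> carrier (poly_ring n)" "?x \<in> carrier (poly_ring n)"
          by (simp_all only: monomial_span_def mem_Collect_eq)
        have "Poly_Mapping.single a (Poly_Mapping.lookup p a) = ?c * ?x"
          by (simp add: mult_single b add.commute)
        moreover have "?c * ?x \<in> carrier (poly_ring n)"
          using h.R.m_closed[OF xc] by simp
        moreover have "h (?c * ?x) \<in> ideal_prod T (h ` ?A t) (h ` ?A 1)"
          using h.hom_mult[OF xc] ideal_prod.prod[of "h ?c" "h ` ?A t" "h ?x" "h ` ?A 1" T] x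
          by simp
        ultimately show "Poly_Mapping.single a (Poly_Mapping.lookup p a) \<in> ?P" by simp
      qed (use closed(1,2) in auto)
    qed
    then show "h ` ?A (Suc t) \<subseteq> ideal_prod T (h ` ?A t) (h ` ?A 1)" by blast
  qed
  then show ?case using Suc.IH by simp
qed

section \<open>The Hilbert--Samuel function of a Stanley--Reisner ring\<close>

lemma (in ideal) quotient_map_surj: "(+>) I ` carrier R = carrier (R Quot I)"
  by (auto simp: FactRing_def A_RCOSETS_def')

lemma (in ideal) quotient_map_eq_zero_iff:
  assumes "x \<in> carrier R"
  shows "I +> x = \<zero>\<^bsub>R Quot I\<^esub> \<longleftrightarrow> x \<in> I"
  using a_coset_join1[OF _ assms a_subgroup] a_rcos_const by (auto simp: FactRing_def)

text \<open>Lower the exponent of a fixed \<open>x \<in> F\<close> by one: the support either stays \<open>F\<close> or becomes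
  \<open>F - {x}\<close>. This is Pascal's rule.\<close>

lemma exponents_with_support:
  assumes "finite F"
  shows "finite {a. Poly_Mapping.keys a = F \<and> mdeg a < Suc t}"
    and "card {a. Poly_Mapping.keys a = F \<and> mdeg a < Suc t} = t choose card F"
proof -
  let ?E = "\<lambda>F t. {a. Poly_Mapping.keys a = F \<and> mdeg a < t}"
  have "finite (?E F (Suc t)) \<and> card (?E F (Suc t)) = t choose card F"
    using assms
  proof (induction t arbitrary: F)
    case 0
    have "?E F (Suc 0) = (if F = {} then {0} else {})"
      by (auto simp: mdeg_def) (auto simp: in_keys_iff)
    then show ?case using 0 by (simp add: card_gt_0_iff)
  next
    case (Suc t)
    show ?case
    proof (cases "F = {}")
      case True
      have "?E F (Suc (Suc t)) = {0}" unfolding True by (auto simp: mdeg_def)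
      then show ?thesis by (simp add: True)
    next
      case False
      then obtain x where x: "x \<in> F" by blast
      let ?G = "F - {x}" and ?up = "(+) (Poly_Mapping.single x 1 :: expvec)"
      have split: "?E F (Suc (Suc t)) = ?up ` (?E F (Suc t) \<union> ?E ?G (Suc t))"
      proof
        show "?E F (Suc (Suc t)) \<subseteq> ?up ` (?E F (Suc t) \<union> ?E ?G (Suc t))"
        proof
          fix a assume a: "a \<in> ?E F (Suc (Suc t))"
          then have "x \<in> Poly_Mapping.keys a" using x by simp
          then obtain b where b: "a = Poly_Mapping.single x 1 + b" by (rule split_off_variable)
          have "insert x (Poly_Mapping.keys b) = F" "mdeg b < Suc t"
            using a by (auto simp: b keys_add_expvec mdeg_add)
          then have "b \<in> ?E F (Suc t) \<union> ?E ?G (Suc t)" by auto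
          then show "a \<in> ?up ` (?E F (Suc t) \<union> ?E ?G (Suc t))" unfolding b by (rule imageI)
        qed
        show "?up ` (?E F (Suc t) \<union> ?E ?G (Suc t)) \<subseteq> ?E F (Suc (Suc t))"
        proof
          fix a assume "a \<in> ?up ` (?E F (Suc t) \<union> ?E ?G (Suc t))"
          then obtain b where b: "a = ?up b" "b \<in> ?E F (Suc t) \<union> ?E ?G (Suc t)" by blast
          have "Poly_Mapping.keys a = insert x (Poly_Mapping.keys b)" "mdeg a = Suc (mdeg b)"
            by (simp_all add: b(1) keys_add_expvec mdeg_add)
          moreover have "insert x (Poly_Mapping.keys b) = F" "mdeg b < Suc t" using b(2) x by blast+
          ultimately show "a \<in> ?E F (Suc (Suc t))" by simp
        qed
      qed
      have disj: "?E F (Suc t) \<inter> ?E ?G (Suc t) = {}" using x by auto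
      have IH: "finite (?E F (Suc t))" "card (?E F (Suc t)) = t choose card F"
        "finite (?E ?G (Suc t))" "card (?E ?G (Suc t)) = t choose card ?G"
        using Suc.IH[OF Suc.prems] Suc.IH[of ?G] Suc.prems by blast+
      have "card (?E F (Suc (Suc t))) = card (?E F (Suc t) \<union> ?E ?G (Suc t))"
        unfolding split by (rule card_image) (auto intro: inj_onI)
      also have "\<dots> = (t choose card F) + (t choose card ?G)"
        by (simp only: card_Un_disjoint[OF IH(1,3) disj] IH(2,4))
      also have "\<dots> = Suc t choose card F"
        using card_Suc_Diff1[OF Suc.prems x] by (metis add.commute binomial_Suc_Suc)
      finally show ?thesis using IH(1,3) by (simp add: split)
    qed
  qed
  then show "finite (?E F (Suc t))" "card (?E F (Suc t)) = t choose card F" by blast+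
qed

lemma finite_complex:
  assumes "simplicial_complex_on {1..n} \<Delta>"
  shows "finite \<Delta>" and "F \<in> \<Delta> \<Longrightarrow> finite F"
  using assms finite_subset[of \<Delta> "Pow {1..n}"] finite_subset[of F "{1..n}"]
  by (auto simp: simplicial_complex_on_def)

lemma standard_exponents:
  assumes "simplicial_complex_on {1..n} \<Delta>"
  shows "finite {a. Poly_Mapping.keys a \<in> \<Delta> \<and> mdeg a < Suc t}"
    and "card {a. Poly_Mapping.keys a \<in> \<Delta> \<and> mdeg a < Suc t} = (\<Sum>F\<in>\<Delta>. t choose card F)"
proof -
  let ?E = "\<lambda>F. {a. Poly_Mapping.keys a = F \<and> mdeg a < Suc t}"
  have eq: "{a. Poly_Mapping.keys a \<in> \<Delta> \<and> mdeg a < Suc t} = (\<Union>F\<in>\<Delta>. ?E F)" by blast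
  note fin = finite_complex[OF assms]
  show "finite {a. Poly_Mapping.keys a \<in> \<Delta> \<and> mdeg a < Suc t}"
    unfolding eq by (intro finite_UN_I fin exponents_with_support(1))
  have "card (\<Union>F\<in>\<Delta>. ?E F) = (\<Sum>F\<in>\<Delta>. card (?E F))"
    using fin exponents_with_support(1) by (intro card_UN_disjoint) auto
  also have "\<dots> = (\<Sum>F\<in>\<Delta>. t choose card F)"
    using fin(2) exponents_with_support(2) by (intro sum.cong) auto
  finally show "card {a. Poly_Mapping.keys a \<in> \<Delta> \<and> mdeg a < Suc t} = (\<Sum>F\<in>\<Delta>. t choose card F)"
    unfolding eq .
qed

text \<open>The quotient of the Stanley--Reisner ring by the \<open>(t + 1)\<close>-th power of its maximal ideal is the polynomial
  ring modulo all monomials that have a nonface as support or degree at least \<open>t + 1\<close>. Its length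
  is the number of remaining monomials, counted by sorting them according to their support.\<close>

lemma hilbert_samuel_function_eq_sum_choose:
  assumes \<Delta>: "simplicial_complex_on {1..n} \<Delta>"
  shows "hilbert_samuel_function (stanley_reisner_ring n \<Delta> :: 'k::field mpoly set ring)
      (stanley_reisner_max_ideal n \<Delta>) (Suc t) =
    enat (\<Sum>F\<in>\<Delta>. t choose card F)"
proof -
  let ?S = "poly_ring n :: 'k mpoly ring"
  let ?I = "stanley_reisner_ideal n \<Delta> :: 'k mpoly set"
  let ?R = "stanley_reisner_ring n \<Delta> :: 'k mpoly set ring"
  let ?A = "monomial_span n {a. Suc t \<le> mdeg a} :: 'k mpoly set"
  let ?B = "{a. Poly_Mapping.keys a \<in> \<Delta> \<and> mdeg a < Suc t}"
  have nonfaces: "up_closed n {a. Poly_Mapping.keys a \<notin> \<Delta>}"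
    using \<Delta> by (auto simp: up_closed_def simplicial_complex_on_def keys_add_expvec)
  interpret I: ideal ?I ?S
    unfolding stanley_reisner_ideal_eq[OF \<Delta>] by (rule monomial_span_ideal[OF nonfaces])
  let ?f = "\<lambda>p. ?I +>\<^bsub>?S\<^esub> p"
  have R: "?R = ?S Quot ?I" by (simp add: stanley_reisner_ring_def)
  have f: "ring_hom_ring ?S ?R ?f" unfolding R by (rule I.rcos_ring_hom_ring)
  have f_surj: "?f ` carrier ?S = carrier ?R" unfolding R by (rule I.quotient_map_surj)
  interpret f: ring_hom_ring ?S ?R ?f by (rule f)
  let ?M = "ideal_pow ?R (stanley_reisner_max_ideal n \<Delta>) (Suc t)"
  have M: "?M = ?f ` ?A"
    unfolding stanley_reisner_max_ideal_def max_ideal_image[OF f f_surj]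
    by (rule max_ideal_pow_image[OF f f_surj])
  interpret M: ideal ?M ?R
    unfolding M by (rule f.image_ideal[OF f_surj monomial_span_ideal[OF up_closed_mdeg]])
  let ?g = "\<lambda>p. ?M +>\<^bsub>?R\<^esub> (?f p)"
  have "(\<lambda>x. ?M +>\<^bsub>?R\<^esub> x) \<circ> ?f \<in> ring_hom ?S (?R Quot ?M)"
    by (rule ring_hom_trans[OF f.homh M.rcos_ring_hom])
  then have g: "ring_hom_ring ?S (?R Quot ?M) ?g"
    by (intro ring_hom_ringI2 I.ring_axioms M.quotient_is_ring) (simp add: comp_def)
  have "?g ` carrier ?S = (\<lambda>x. ?M +>\<^bsub>?R\<^esub> x) ` (?f ` carrier ?S)"
    by (simp only: image_image)
  then have g_surj: "?g ` carrier ?S = carrier (?R Quot ?M)"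
    unfolding f_surj M.quotient_map_surj .
  have "a_kernel ?S (?R Quot ?M) ?g = {p \<in> carrier ?S. ?f p \<in> ?M}"
    unfolding a_kernel_def' using M.quotient_map_eq_zero_iff f.hom_closed by blast
  also have "\<dots> = monomial_span n (- ?B)"
  proof
    show "{p \<in> carrier ?S. ?f p \<in> ?M} \<subseteq> monomial_span n (- ?B)"
    proof
      fix p assume p: "p \<in> {p \<in> carrier ?S. ?f p \<in> ?M}"
      then obtain q where q: "q \<in> ?A" "?f p = ?f q" unfolding M by blast
      have "p \<in> ?I +>\<^bsub>?S\<^esub> q" using I.a_rcos_self[of p] p q(2) by simp
      then obtain r where r: "r \<in> ?I" "p = r + q" by (auto simp: a_r_coset_def')
      have "Poly_Mapping.keys p \<subseteq> Poly_Mapping.keys r \<union> Poly_Mapping.keys q"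
        unfolding r(2) by (rule Poly_Mapping.keys_add)
      moreover have "Poly_Mapping.keys r \<subseteq> - ?B"
        using r(1) unfolding stanley_reisner_ideal_eq[OF \<Delta>] by (auto simp: monomial_span_def)
      moreover have "Poly_Mapping.keys q \<subseteq> - ?B" using q(1) by (auto simp: monomial_span_def)
      ultimately show "p \<in> monomial_span n (- ?B)" using p by (auto simp: monomial_span_def)
    qed
    note closed = ideal_poly_ring_closed[OF f.ideal_vimage[OF M.is_ideal]]
    show "monomial_span n (- ?B) \<subseteq> {p \<in> carrier ?S. ?f p \<in> ?M}"
    proof
      fix p :: "'k mpoly" assume p: "p \<in> monomial_span n (- ?B)"
      show "p \<in> {p \<in> carrier ?S. ?f p \<in> ?M}"
      proof (rule mem_of_terms)
        fix a assume a: "a \<in> Poly_Mapping.keys p"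
        let ?p = "Poly_Mapping.single a (Poly_Mapping.lookup p a)"
        have c: "?p \<in> carrier ?S"
          using a p by (auto simp: monomial_span_def carrier_poly_ring)
        have "Poly_Mapping.keys a \<notin> \<Delta> \<or> Suc t \<le> mdeg a" using a p by (auto simp: monomial_span_def)
        then have "?f ?p \<in> ?M"
        proof
          assume "Poly_Mapping.keys a \<notin> \<Delta>"
          then have "?p \<in> ?I"
            unfolding stanley_reisner_ideal_eq[OF \<Delta>] using c by (simp add: monomial_span_def)
          then have "?f ?p = \<zero>\<^bsub>?R\<^esub>" unfolding R using I.quotient_map_eq_zero_iff[OF c] by simp
          then show ?thesis using M.zero_closed by simp
        next
          assume "Suc t \<le> mdeg a"
          then have "?p \<in> ?A" using c by (simp add: monomial_span_def)
          then show ?thesis unfolding M by (rule imageI)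
        qed
        then show "?p \<in> {p \<in> carrier ?S. ?f p \<in> ?M}" using c by simp
      qed (use closed(1,2) in auto)
    qed
  qed
  finally have ker: "a_kernel ?S (?R Quot ?M) ?g = monomial_span n (- ?B)" .
  have Bn: "Poly_Mapping.keys b \<subseteq> {1..n}" if "b \<in> ?B" for b
    using that \<Delta> by (auto simp: simplicial_complex_on_def)
  have fin: "finite ?B" by (rule standard_exponents(1)[OF \<Delta>])
  have up: "up_closed n (- ?B)"
    using nonfaces by (auto simp: up_closed_def mdeg_add)
  show ?thesis
    unfolding hilbert_samuel_function_def standard_exponents(2)[OF \<Delta>, symmetric]
    by (rule ring_length_monomial_quotient[OF g g_surj ker fin Bn up])
qed

section \<open>Multiplicity and the number of largest faces\<close>

text \<open>The polynomial $\binom{x-1}{k}$. The shift is needed because the monomials of degree less than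
  \<open>t \<ge> 1\<close> with support \<open>F\<close> number $\binom{t-1}{|F|}$.\<close>

definition shifted_binomial_poly :: "nat \<Rightarrow> rat poly" where
  "shifted_binomial_poly k = smult (1 / fact k) (\<Prod>i<k. [:- of_nat (Suc i), 1:])"

lemma poly_shifted_binomial_poly:
  "poly (shifted_binomial_poly k) (of_nat (Suc t)) = of_nat (t choose k)"
proof -
  have "poly (shifted_binomial_poly k) (of_nat (Suc t)) =
      (\<Prod>i<k. of_nat t - of_nat i) / (fact k :: rat)"
    by (simp add: shifted_binomial_poly_def poly_prod)
  also have "\<dots> = of_nat t gchoose k"
    by (simp add: gbinomial_prod_rev atLeast0LessThan)
  finally show ?thesis by (simp add: binomial_gbinomial)
qed

lemma degree_shifted_binomial_poly: "Polynomial.degree (shifted_binomial_poly k) = k"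
  by (simp add: shifted_binomial_poly_def degree_prod_eq_sum_degree)

lemma coeff_shifted_binomial_poly:
  assumes "k \<le> d"
  shows "Polynomial.coeff (shifted_binomial_poly k) d = (if k = d then 1 / fact d else 0)"
proof (cases "k = d")
  case True
  have "Polynomial.lead_coeff (shifted_binomial_poly k) = 1 / fact k"
    by (simp only: shifted_binomial_poly_def lead_coeff_smult lead_coeff_prod) simp
  then show ?thesis using True by (simp add: degree_shifted_binomial_poly)
next
  case False
  then show ?thesis using assms by (simp add: coeff_eq_0 degree_shifted_binomial_poly)
qed

lemma hilbert_samuel_poly_eqI:
  assumes P: "is_hilbert_samuel_poly R J P"
  shows "hilbert_samuel_poly R J = P"
  unfolding hilbert_samuel_poly_def
proof (rule the_equality)
  show "is_hilbert_samuel_poly R J P" by (rule P)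
next
  fix Q assume "is_hilbert_samuel_poly R J Q"
  then have "\<forall>\<^sub>F t in sequentially. poly (Q - P) (of_nat t) = 0"
    using P unfolding is_hilbert_samuel_poly_def
    by eventually_elim auto
  then obtain N where N: "\<And>t. t \<ge> N \<Longrightarrow> poly (Q - P) (of_nat t) = 0"
    unfolding eventually_sequentially by blast
  have "infinite ((of_nat :: nat \<Rightarrow> rat) ` {N..})"
  proof
    assume "finite ((of_nat :: nat \<Rightarrow> rat) ` {N..})"
    then have "finite {N..}" by (rule finite_imageD) (simp add: inj_on_def)
    then show False using infinite_Ici by blast
  qed
  moreover have "of_nat ` {N..} \<subseteq> {x. poly (Q - P) x = 0}" using N by auto
  ultimately have "infinite {x. poly (Q - P) x = 0}" using finite_subset by blast
  then have "Q - P = 0" using poly_roots_finite by blast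
  then show "Q = P" by simp
qed

text \<open>The Hilbert--Samuel polynomial is the sum of $\binom{x-1}{|F|}$ over all faces \<open>F\<close>. Only the
  faces of the maximal size \<open>d\<close> reach degree \<open>d\<close>, and each contributes \<open>1 / d!\<close> to the leading
  coefficient.\<close>

lemma multiplicity_stanley_reisner_ring:
  assumes \<Delta>: "simplicial_complex_on {1..n} \<Delta>"
    and d: "\<And>F. F \<in> \<Delta> \<Longrightarrow> card F \<le> d" and ex: "\<exists>F\<in>\<Delta>. card F = d"
  shows "hilbert_samuel_multiplicity (stanley_reisner_ring n \<Delta> :: 'k::field mpoly set ring)
      (stanley_reisner_max_ideal n \<Delta>) = of_nat (card {F \<in> \<Delta>. card F = d})"
proof -
  let ?R = "stanley_reisner_ring n \<Delta> :: 'k mpoly set ring"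
  let ?M = "stanley_reisner_max_ideal n \<Delta> :: 'k mpoly set set"
  define P where "P = (\<Sum>F\<in>\<Delta>. shifted_binomial_poly (card F))"
  have fin: "finite \<Delta>" by (rule finite_complex[OF \<Delta>])
  have "is_hilbert_samuel_poly ?R ?M P"
    unfolding is_hilbert_samuel_poly_def
  proof (rule eventually_sequentiallyI)
    fix t :: nat assume "1 \<le> t"
    then obtain u where t: "t = Suc u" by (cases t) auto
    have "poly P (of_nat t) = of_nat (\<Sum>F\<in>\<Delta>. u choose card F)"
      unfolding t P_def poly_sum poly_shifted_binomial_poly by simp
    then show "\<exists>h. hilbert_samuel_function ?R ?M t = enat h \<and> poly P (of_nat t) = of_nat h"
      using hilbert_samuel_function_eq_sum_choose[OF \<Delta>] t by blast
  qed
  then have HP: "hilbert_samuel_poly ?R ?M = P" by (rule hilbert_samuel_poly_eqI)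
  have "Polynomial.coeff P d = (\<Sum>F\<in>\<Delta>. if card F = d then 1 / fact d else 0)"
    unfolding P_def coeff_sum using d by (intro sum.cong) (auto simp: coeff_shifted_binomial_poly)
  also have "\<dots> = (\<Sum>F\<in>{F \<in> \<Delta>. card F = d}. 1 / fact d)"
    by (rule sum.inter_filter[OF fin, symmetric])
  finally have lead: "Polynomial.coeff P d = of_nat (card {F \<in> \<Delta>. card F = d}) / fact d" by simp
  have "card {F \<in> \<Delta>. card F = d} \<noteq> 0" using fin ex by auto
  then have "d \<le> Polynomial.degree P" by (intro le_degree) (simp add: lead)
  moreover have "Polynomial.degree P \<le> d"
    unfolding P_def using fin d by (intro degree_sum_le) (auto simp: degree_shifted_binomial_poly)
  ultimately have "Polynomial.degree P = d" by simp
  then show ?thesis by (simp add: hilbert_samuel_multiplicity_def HP lead)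
qed

section \<open>Faces of lexsegment complexes\<close>

lemma mdeg_set_expvec: "finite G \<Longrightarrow> mdeg (set_expvec G) = card G"
  by (simp add: mdeg_def keys_set_expvec lookup_set_expvec)

lemma set_expvec_less_iff:
  assumes "finite A" "finite B"
  shows "set_expvec A < set_expvec B \<longleftrightarrow>
    (\<exists>k. k \<in> B \<and> k \<notin> A \<and> (\<forall>i<k. i \<in> A \<longleftrightarrow> i \<in> B))"
proof -
  have "(if k \<in> A then 1 else (0::nat)) = (if k \<in> B then 1 else 0) \<longleftrightarrow> (k \<in> A \<longleftrightarrow> k \<in> B)" for k
    by simp
  moreover have "(if k \<in> A then 1 else (0::nat)) < (if k \<in> B then 1 else 0) \<longleftrightarrow> k \<in> B \<and> k \<notin> A" for k
    by simp
  ultimately show ?thesis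
    by (simp only: less_poly_mapping.rep_eq less_fun_def lookup_set_expvec[OF assms(1)]
        lookup_set_expvec[OF assms(2)] conj_assoc)
qed

lemma set_expvec_eq_iff: "finite A \<Longrightarrow> finite B \<Longrightarrow> set_expvec A = set_expvec B \<longleftrightarrow> A = B"
  by (metis keys_set_expvec)

text \<open>Squarefree monomials are handled from here on as sets of indices.\<close>

lemma sqfree_monomials_eq:
  "sqfree_monomials n q = set_expvec ` {W. W \<subseteq> {1..n} \<and> card W = q}"
proof
  show "sqfree_monomials n q \<subseteq> set_expvec ` {W. W \<subseteq> {1..n} \<and> card W = q}"
  proof
    fix w assume w: "w \<in> sqfree_monomials n q"
    have "Poly_Mapping.lookup w i = (if i \<in> Poly_Mapping.keys w then 1 else 0)" for i
    proof -
      have "Poly_Mapping.lookup w i \<le> 1" using w by (simp add: sqfree_monomials_def)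
      then show ?thesis by (auto simp: in_keys_iff)
    qed
    then have eq: "w = set_expvec (Poly_Mapping.keys w)"
      by (intro poly_mapping_eqI) (simp add: lookup_set_expvec)
    moreover have "card (Poly_Mapping.keys w) = q"
      using w mdeg_set_expvec[of "Poly_Mapping.keys w"] eq by (simp add: sqfree_monomials_def)
    ultimately show "w \<in> set_expvec ` {W. W \<subseteq> {1..n} \<and> card W = q}"
      using w unfolding sqfree_monomials_def by blast
  qed
  show "set_expvec ` {W. W \<subseteq> {1..n} \<and> card W = q} \<subseteq> sqfree_monomials n q"
  proof
    fix w assume "w \<in> set_expvec ` {W. W \<subseteq> {1..n} \<and> card W = q}"
    then obtain W where W: "W \<subseteq> {1..n}" "card W = q" "w = set_expvec W" by blast
    then have "finite W" using finite_subset by blast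
    then show "w \<in> sqfree_monomials n q"
      using W by (simp add: sqfree_monomials_def keys_set_expvec lookup_set_expvec mdeg_set_expvec)
  qed
qed

text \<open>Test the two descriptions of the ideal on the squarefree monomial of \<open>G\<close>: it lies in the
  Stanley--Reisner ideal exactly if \<open>G\<close> is a nonface, and in the lexsegment ideal exactly if some
  generator divides it.\<close>

lemma lexsegment_faces:
  assumes \<Delta>: "simplicial_complex_on {1..n} \<Delta>"
    and I: "stanley_reisner_ideal n \<Delta> = (lexsegment_ideal n (set_expvec V) :: 'k::field mpoly set)"
    and V: "finite V" and G: "G \<subseteq> {1..n}"
  shows "G \<in> \<Delta> \<longleftrightarrow> \<not> (\<exists>W\<subseteq>G. card W = card V \<and> set_expvec V \<le> set_expvec W)"
proof -
  let ?L = "initial_lexsegment n (set_expvec V)"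
  have finG: "finite G" using G finite_subset by blast
  have L: "?L = set_expvec ` {W. W \<subseteq> {1..n} \<and> card W = card V \<and> set_expvec V \<le> set_expvec W}"
    unfolding initial_lexsegment_def sqfree_monomials_eq mdeg_set_expvec[OF V] by blast
  have gens: "Poly_Mapping.keys w \<subseteq> {1..n}" if "w \<in> ?L" for w
    using that by (simp add: initial_lexsegment_def sqfree_monomials_def)
  have mem: "monomial (set_expvec G) \<in> (monomial_span n U :: 'k mpoly set) \<longleftrightarrow> set_expvec G \<in> U" for U
    using G by (simp add: monomial_span_def carrier_poly_ring keys_set_expvec[OF finG])
  have lex: "lexsegment_ideal n (set_expvec V) =
      (monomial_span n {a. \<exists>w\<in>?L. \<exists>b. a = w + b} :: 'k mpoly set)"
    unfolding lexsegment_ideal_def by (rule genideal_monomials) (rule gens)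
  have "G \<notin> \<Delta> \<longleftrightarrow> monomial (set_expvec G) \<in> (stanley_reisner_ideal n \<Delta> :: 'k mpoly set)"
    unfolding stanley_reisner_ideal_eq[OF \<Delta>] mem by (simp add: keys_set_expvec[OF finG])
  also have "\<dots> \<longleftrightarrow> (\<exists>w\<in>?L. \<exists>b. set_expvec G = w + b)"
    unfolding I lex mem by simp
  also have "\<dots> \<longleftrightarrow> (\<exists>W\<subseteq>G. card W = card V \<and> set_expvec V \<le> set_expvec W)"
  proof
    assume "\<exists>w\<in>?L. \<exists>b. set_expvec G = w + b"
    then obtain W b where W: "W \<subseteq> {1..n}" "card W = card V" "set_expvec V \<le> set_expvec W"
      and b: "set_expvec G = set_expvec W + b" unfolding L by blast
    have "finite W" using W(1) finite_subset by blast
    then have "W \<subseteq> G"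
      using set_expvec_divides_iff[of W "set_expvec G"] b keys_set_expvec[OF finG] by auto
    then show "\<exists>W\<subseteq>G. card W = card V \<and> set_expvec V \<le> set_expvec W" using W by blast
  next
    assume "\<exists>W\<subseteq>G. card W = card V \<and> set_expvec V \<le> set_expvec W"
    then obtain W where W: "W \<subseteq> G" "card W = card V" "set_expvec V \<le> set_expvec W" by blast
    have "finite W" using W(1) finG finite_subset by blast
    then have "\<exists>b. set_expvec G = set_expvec W + b"
      using set_expvec_divides_iff[of W "set_expvec G"] keys_set_expvec[OF finG] W(1) by simp
    then show "\<exists>w\<in>?L. \<exists>b. set_expvec G = w + b" unfolding L using W G by blast
  qed
  finally show ?thesis by blast
qed

text \<open>Here \<open>a\<close> is the least element of \<open>V\<close> and \<open>{a..<a + r}\<close> its initial run of consecutive numbers.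
  Sets are compared at the least element of their symmetric difference, and the larger
  one contains that element. Deleting an element \<open>m\<close> of the initial run from \<open>{a..n}\<close> leaves only
  subsets that lack \<open>m\<close> and contain no number up to \<open>m\<close> outside \<open>V\<close>, so they are smaller than \<open>V\<close>.
  Conversely a face with at least as many elements as \<open>V\<close> cannot reach below \<open>a\<close>, where it would
  already beat \<open>V\<close>, so a large face omits at most one element of \<open>{a..n}\<close>. It must omit an element of \<open>V\<close>, since \<open>V\<close> itself is not a face; and that element cannot come
  after the initial run, because the face would then contain \<open>{a..a + r}\<close>, which can be completed
  to a set larger than \<open>V\<close>.\<close>

lemma largest_lexsegment_faces:
  fixes V :: "nat set" and a r n :: nat
  assumes V: "V \<subseteq> {a..n}" "{a..<a + r} \<subseteq> V" "a + r \<notin> V" and r: "0 < r" and q: "card V \<le> n - a"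
  defines "face F \<equiv> \<not> (\<exists>W\<subseteq>F. card W = card V \<and> set_expvec V \<le> set_expvec W)"
  shows "m \<in> {a..<a + r} \<Longrightarrow> face ({a..n} - {m})"
    and "F \<subseteq> {1..n} \<Longrightarrow> face F \<Longrightarrow> n - a \<le> card F \<Longrightarrow> \<exists>m\<in>{a..<a + r}. F = {a..n} - {m}"
proof -
  have finV: "finite V" using V(1) finite_subset by blast
  assume m: "m \<in> {a..<a + r}"
  show "face ({a..n} - {m})"
    unfolding face_def
  proof
    assume "\<exists>W\<subseteq>{a..n} - {m}. card W = card V \<and> set_expvec V \<le> set_expvec W"
    then obtain W where W: "W \<subseteq> {a..n} - {m}" "set_expvec V \<le> set_expvec W" by blast
    have finW: "finite W" using W(1) finite_subset by blast
    have mVW: "m \<in> V" "m \<notin> W" using m V(2) W(1) by blast+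
    then have "set_expvec V < set_expvec W"
      using W(2) set_expvec_eq_iff[OF finV finW] by (auto simp: order.order_iff_strict)
    then obtain k where k: "k \<in> W" "k \<notin> V" "\<And>i. i < k \<Longrightarrow> i \<in> V \<longleftrightarrow> i \<in> W"
      using set_expvec_less_iff[OF finV finW] by blast
    have "a \<le> k" using k(1) W(1) by auto
    then have "m < k" using k(2) V(2) m by (meson atLeastLessThan_iff less_le_trans not_less subsetD)
    then show False using k(3) mVW by blast
  qed
next
  have finV: "finite V" using V(1) finite_subset by blast
  have aV: "a \<in> V" using V(2) r by auto
  then have an: "a \<le> n" "0 < card V" using V(1) finV by (auto simp: card_gt_0_iff)
  assume F: "F \<subseteq> {1..n}" "face F" "n - a \<le> card F"
  have finF: "finite F" using F(1) finite_subset by blast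
  have qF: "card V \<le> card F" using q F(3) by simp
  (* It suffices to find a small part T of F that forces every set between T and F above V:
     completing T inside F to the size of V then yields a generator supported on F. *)
  have noW: False if T: "T \<subseteq> F" "card T \<le> card V"
    and less: "\<And>W. finite W \<Longrightarrow> T \<subseteq> W \<Longrightarrow> W \<subseteq> F \<Longrightarrow> set_expvec V < set_expvec W" for T
  proof -
    obtain W where W: "T \<subseteq> W" "W \<subseteq> F" "card W = card V"
      using exists_subset_between[OF T(2) qF T(1) finF] by blast
    then have "set_expvec V < set_expvec W" using less finite_subset[OF W(2) finF] by blast
    then show False using F(2) W unfolding face_def by (auto dest: less_imp_le)
  qed
  have Fa: "F \<subseteq> {a..n}"
  proof (rule ccontr)
    assume "\<not> F \<subseteq> {a..n}"
    then obtain k where k: "k \<in> F" "k < a" using F(1) by fastforce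
    show False
    proof (rule noW[of "{k}"])
      fix W assume W: "finite W" "{k} \<subseteq> W" "W \<subseteq> F"
      define l where "l = Min W"
      have l: "l \<in> W" unfolding l_def using W by (intro Min_in) auto
      have before: "i \<notin> W" if "i < l" for i
        using that Min_le[OF W(1)] unfolding l_def by (meson leD)
      have "l \<le> k" using W by (simp add: l_def)
      then have below: "\<And>i. i \<le> l \<Longrightarrow> i \<notin> V" using k(2) V(1) by fastforce
      show "set_expvec V < set_expvec W"
        unfolding set_expvec_less_iff[OF finV W(1)] using l before below by (intro exI[of _ l]) auto
    qed (use k an in auto)
  qed
  have "\<not> V \<subseteq> F" using F(2) unfolding face_def by blast
  then obtain m where m: "m \<in> V" "m \<notin> F" by blast
  have man: "m \<in> {a..n}" using m V(1) by blast
  have sub: "F \<subseteq> {a..n} - {m}" using Fa m by blast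
  moreover have "card ({a..n} - {m}) \<le> card F" using man F(3) by simp
  ultimately have eq: "F = {a..n} - {m}" by (intro card_seteq) auto
  have "m < a + r"
  proof (rule ccontr)
    assume "\<not> m < a + r"
    then have mr: "a + r < m" using m V(3) by (metis linorder_neqE_nat)
    show False
    proof (rule noW[of "{a..a + r}"])
      show "{a..a + r} \<subseteq> F" using mr man unfolding eq by auto
      (* m lies in V beyond the initial run, so there is room for one more element *)
      have "insert m {a..<a + r} \<subseteq> V" using m V(2) by blast
      then have "card (insert m {a..<a + r}) \<le> card V" by (rule card_mono[OF finV])
      then show "card {a..a + r} \<le> card V" using mr by simp
      fix W assume W: "finite W" "{a..a + r} \<subseteq> W" "W \<subseteq> F"
      have "i \<in> V \<longleftrightarrow> i \<in> W" if "i < a + r" for i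
      proof (cases "a \<le> i")
        case True
        then show ?thesis using that V(2) W(2) by auto
      next
        case False
        then show ?thesis using V(1) W(3) Fa by auto
      qed
      then show "set_expvec V < set_expvec W"
        unfolding set_expvec_less_iff[OF finV W(1)] using W(2) V(3)
        by (intro exI[of _ "a + r"]) auto
    qed
  qed
  then show "\<exists>m\<in>{a..<a + r}. F = {a..n} - {m}"
    using eq man by (intro bexI[of _ m]) simp_all
qed

text \<open>Strict monotonicity keeps all indices from the gap on beyond the skipped number; if the gap is
  at \<open>q + 1\<close>, there are no such indices.\<close>

lemma consecutive_prefix:
  fixes j :: "nat \<Rightarrow> nat"
  assumes mono: "strict_mono_on {1..q} j" and s: "s \<in> {1..q + 1}" and gap: "gap_at q j s"
  shows "{j 1..<j 1 + (s - 1)} \<subseteq> j ` {1..q}" and "j 1 + (s - 1) \<notin> j ` {1..q}"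
proof -
  have start: "j i = j 1 + (i - 1)" if "1 \<le> i" "i < s" for i
    using gap that unfolding gap_at_def by blast
  show "{j 1..<j 1 + (s - 1)} \<subseteq> j ` {1..q}"
  proof
    fix x assume x: "x \<in> {j 1..<j 1 + (s - 1)}"
    define i where "i = x - j 1 + 1"
    have i: "1 \<le> i" "i < s" "x = j 1 + (i - 1)" using x by (auto simp: i_def)
    then have "x = j i" "i \<in> {1..q}" using start[OF i(1,2)] s by auto
    then show "x \<in> j ` {1..q}" by (rule image_eqI)
  qed
  show "j 1 + (s - 1) \<notin> j ` {1..q}"
  proof
    assume "j 1 + (s - 1) \<in> j ` {1..q}"
    then obtain i where i: "i \<in> {1..q}" "j 1 + (s - 1) = j i" by blast
    show False
    proof (cases "i < s")
      case True
      have "1 \<le> i" using i(1) by simp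
      then have "j i = j 1 + (i - 1)" by (rule start[OF _ True])
      then show False using i(2) True \<open>1 \<le> i\<close> by linarith
    next
      case False
      then have "s \<le> q" "s \<le> i" using i(1) by auto
      have "j 1 + s \<le> j s" using gap \<open>s \<le> q\<close> unfolding gap_at_def by blast
      moreover have "j s \<le> j i"
        using i(1) s \<open>s \<le> q\<close> \<open>s \<le> i\<close> by (intro strict_mono_on_leD[OF mono]) auto
      moreover have "1 \<le> s" using s by simp
      ultimately show False using i(2) by linarith
    qed
  qed
qed

section \<open>The multiplicity of an initial lexsegment complex\<close>

theorem corollary2p1p5:
  fixes n q s :: nat
    and j :: "nat \<Rightarrow> nat"
    and v :: expvec
    and I :: "'k::field mpoly set"
    and \<Delta> :: "nat set set"
  assumes "2 \<le> q"
    and "2 \<le> j 1"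
    and "strict_mono_on {1..q} j"
    and "j q \<le> n"
    and "v = set_expvec (j ` {1..q})"
    and "v \<noteq> set_expvec {n - q + 1..n}"
    and "I = lexsegment_ideal n v"
    and "simplicial_complex_on {1..n} \<Delta>"
    and "stanley_reisner_ideal n \<Delta> = I"
    and "s \<in> {1..q + 1}"
    and "gap_at q j s"
    and "\<forall>r\<in>{1..q + 1}. gap_at q j r \<longrightarrow> s \<le> r"
  shows "hilbert_samuel_multiplicity (stanley_reisner_ring n \<Delta> :: 'k mpoly set ring)
           (stanley_reisner_max_ideal n \<Delta>) = of_nat s - 1"
proof -
  define V where "V = j ` {1..q}"
  define a where "a = j 1"
  define r where "r = s - 1"
  have finV: "finite V" by (simp add: V_def)
  have cardV: "card V = q"
    unfolding V_def using strict_mono_on_imp_inj_on[OF assms(3)] by (simp add: card_image)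
  have Van: "V \<subseteq> {a..n}"
  proof
    fix x assume "x \<in> V"
    then obtain i where i: "i \<in> {1..q}" "x = j i" unfolding V_def by blast
    then have "j 1 \<le> j i" "j i \<le> j q"
      using strict_mono_on_leD[OF assms(3), of 1 i] strict_mono_on_leD[OF assms(3), of i q] by auto
    then show "x \<in> {a..n}" using i assms(4) by (simp add: a_def)
  qed
  (* A gap at 1 would mean j 1 + 1 <= j 1. *)
  have "s \<noteq> 1" using assms(1,11) by (auto simp: gap_at_def)
  then have r: "0 < r" "s = Suc r" using assms(10) by (auto simp: r_def)
  have prefix: "{a..<a + r} \<subseteq> V" "a + r \<notin> V"
    using consecutive_prefix[OF assms(3,10,11)] unfolding V_def a_def r_def .
  have "a \<in> V" using prefix(1) r(1) by auto
  then have a: "1 \<le> a" "a \<le> n" using Van assms(2) by (auto simp: a_def)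
  (* This is where the smallest monomial has to be excluded: for it {a..n} - {m} has q - 1
     elements, and every set of q - 1 indices is a face. *)
  have qn: "card V \<le> n - a"
  proof (rule ccontr)
    assume large: "\<not> card V \<le> n - a"
    have "V = {a..n}"
      using large by (intro card_seteq[OF _ Van]) auto
    moreover from this have "a = n - q + 1" using cardV large a by simp
    ultimately show False using assms(5,6) by (simp add: V_def)
  qed
  have face: "G \<in> \<Delta> \<longleftrightarrow> \<not> (\<exists>W\<subseteq>G. card W = card V \<and> set_expvec V \<le> set_expvec W)"
    if "G \<subseteq> {1..n}" for G
    using lexsegment_faces[OF assms(8) _ finV that] assms(5,7,9) unfolding V_def by blast
  note faces = largest_lexsegment_faces[OF Van prefix r(1) qn]
  have sub: "F \<subseteq> {1..n}" if "F \<in> \<Delta>" for F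
    using that assms(8) by (auto simp: simplicial_complex_on_def)
  have in_an: "{a..<a + r} \<subseteq> {a..n}" using prefix(1) Van by blast
  have card: "card ({a..n} - {m}) = n - a" if "m \<in> {a..<a + r}" for m
    using that in_an by (subst card_Diff_singleton) auto
  have in_\<Delta>: "{a..n} - {m} \<in> \<Delta>" if "m \<in> {a..<a + r}" for m
  proof -
    have "{a..n} - {m} \<subseteq> {1..n}" using a(1) by auto
    then show ?thesis using face faces(1)[OF that] by blast
  qed
  have large: "\<exists>m\<in>{a..<a + r}. F = {a..n} - {m}" if "F \<in> \<Delta>" "n - a \<le> card F" for F
    using faces(2)[OF sub[OF that(1)] _ that(2)] face[OF sub[OF that(1)]] that(1) by blast
  have le: "card F \<le> n - a" if "F \<in> \<Delta>" for F
    using large[OF that] card by (metis nat_le_linear order_refl)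
  have "a \<in> {a..<a + r}" using r(1) by simp
  then have ex: "\<exists>F\<in>\<Delta>. card F = n - a" using in_\<Delta> card by blast
  have "{F \<in> \<Delta>. card F = n - a} = (\<lambda>m. {a..n} - {m}) ` {a..<a + r}"
  proof
    show "{F \<in> \<Delta>. card F = n - a} \<subseteq> (\<lambda>m. {a..n} - {m}) ` {a..<a + r}"
      using large[OF _ eq_imp_le[OF sym]] by blast
    show "(\<lambda>m. {a..n} - {m}) ` {a..<a + r} \<subseteq> {F \<in> \<Delta>. card F = n - a}"
      using in_\<Delta> card by blast
  qed
  moreover have "inj_on (\<lambda>m. {a..n} - {m}) {a..<a + r}"
    using in_an by (intro inj_onI) blast
  ultimately have "card {F \<in> \<Delta>. card F = n - a} = r" by (simp add: card_image)
  then show ?thesis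
    using multiplicity_stanley_reisner_ring[OF assms(8) le ex] by (simp add: r(2))
qed

end
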